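(* Denote by $NMon(n,D,h)$ the number of possible monomial ideals in $n$ variables, with generating monomials of degree no more than $D$ and given Hilbert function $h$. Then $NMon(n,D,h)$ is equal to the number of vertices of the $0$-$1$ convex polytope $Q(n,D,h)$ defined by $$\sum_{|\alpha|=L}x_\alpha=\binom{n+L-1}{L}-h(L)\quad\text{for all }L=1,\dots,D,$$ $$x_\alpha\le x_\gamma\quad\text{for all }\alpha\le\gamma\text{ with }|\alpha|+1=|\gamma|,$$ where $\alpha,\gamma$ denote exponent vectors of monomials in $n$ variables of total degree no more than $D$; thus the system has $\binom{n+D}{D}-1$ variables $x_\alpha$.
   Context: Ideals are in the polynomial ring $k[x_1,\dots,x_n]$ over a field $k$. The variables $x_\alpha$ are indexed by $\alpha\in\mathbb Z_{\ge0}^n$ with $0<|\alpha|\le D$, where $|\alpha|=\sum_i\alpha_i$; they are indicator variables recording whether the monomial $x^\alpha$ is chosen to be in the ideal ($x_\alpha=1$) or not ($x_\alpha=0$). The order $\alpha\le\gamma$ is componentwise. For a monomial ideal $I$, the Hilbert function value $h_I(d)$ is the number of monomials of degree exactly $d$ not contained in $I$.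
   Formalization: The Hilbert function is prescribed only in degrees 1 to D and ideals are proper (in all degrees the claim fails: n=D=2, h=1,2,1,0,… gives one ideal but three vertices); Q is the convex hull of the 0-1 solutions, since the linear system alone can have fractional vertices. *)

theory Defs
  imports "HOL-Analysis.Analysis" "HOL-Analysis.Finite_Function_Topology"
begin

text \<open>
  The ring \<open>k[x\<^sub>1,\<dots>,x\<^sub>n]\<close> is the type \<open>(nat^'n, 'k) poly_mapping\<close> with \<open>n = CARD('n)\<close>:
  finitely supported functions from exponent vectors to coefficients, multiplied by convolution.
  The order on \<open>nat^'n\<close> is componentwise.
\<close>

global_interpretation ideal: module "(*) :: 'a::comm_ring_1 \<Rightarrow> 'a \<Rightarrow> 'a"
  by standard (simp_all add: algebra_simps)

definition total_degree :: "nat^'n \<Rightarrow> nat" where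
  "total_degree \<alpha> = (\<Sum>i\<in>UNIV. \<alpha> $ i)"

definition monomial :: "nat^'n \<Rightarrow> (nat^'n, 'k::field) poly_mapping" where
  "monomial \<alpha> = Poly_Mapping.single \<alpha> 1"

definition hilbert_fun :: "(nat^'n, 'k::field) poly_mapping set \<Rightarrow> nat \<Rightarrow> nat" where
  "hilbert_fun I d =
     card {\<alpha>. total_degree \<alpha> = d \<and> (monomial \<alpha> :: (nat^'n, 'k) poly_mapping) \<notin> I}"

text \<open>
  The ideals counted by \<open>NMon(n,D,h)\<close>.  Only \<open>h(1),\<dots>,h(D)\<close> are given.  Ideals are proper: there
  is no indicator variable for the constant monomial, so the unit ideal could not be told apart
  from the ideal generated by all variables.
\<close>

definition monomial_ideals ::
    "nat \<Rightarrow> (nat \<Rightarrow> nat) \<Rightarrow> (nat^'n, 'k::field) poly_mapping set set" where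
  "monomial_ideals D h =
     {I. (\<exists>A. (\<forall>\<alpha>\<in>A. total_degree \<alpha> \<le> D) \<and> I = ideal.span (monomial ` A)) \<and>
         I \<noteq> UNIV \<and>
         (\<forall>L\<in>{1..D}. hilbert_fun I L = h L)}"

definition variables :: "nat \<Rightarrow> (nat^'n) set" where
  "variables D = {\<alpha>. 0 < total_degree \<alpha> \<and> total_degree \<alpha> \<le> D}"

text \<open>
  Points \<open>(x\<^sub>\<alpha>)\<close> are real functions supported on \<^term>\<open>variables D\<close>.  As this is the coordinate
  space \<open>\<real>\<^bsup>N\<^esup>\<close> with \<open>N\<close> depending on the value \<open>D\<close>, it is realised inside a type of finitely
  supported functions.
\<close>

definition linear_system :: "nat \<Rightarrow> (nat \<Rightarrow> nat) \<Rightarrow> (nat^'n, real) poly_mapping set" where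
  "linear_system D h =
     {x. Poly_Mapping.keys x \<subseteq> variables D \<and>
         (\<forall>L\<in>{1..D}. (\<Sum>\<alpha> | total_degree \<alpha> = L. Poly_Mapping.lookup x \<alpha>) =
            real ((CARD('n) + L - 1) choose L) - real (h L)) \<and>
         (\<forall>\<alpha>\<in>variables D. \<forall>\<gamma>\<in>variables D.
            \<alpha> \<le> \<gamma> \<and> total_degree \<alpha> + 1 = total_degree \<gamma> \<longrightarrow>
            Poly_Mapping.lookup x \<alpha> \<le> Poly_Mapping.lookup x \<gamma>)}"

text \<open>
  The 0-1 polytope defined by the system is the convex hull of the 0-1 solutions.  It is in general
  smaller than the set of solutions in the unit cube: for \<open>n = D = 2\<close> and \<open>h(1) = h(2) = 1\<close> the
  latter has a vertex with \<open>x\<^sub>2\<^sub>0 = 1\<close> and all other coordinates \<open>1/2\<close>.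
\<close>

definition Q_polytope :: "nat \<Rightarrow> (nat \<Rightarrow> nat) \<Rightarrow> (nat^'n, real) poly_mapping set" where
  "Q_polytope D h =
     convex hull {x \<in> linear_system D h. \<forall>\<alpha>\<in>variables D. Poly_Mapping.lookup x \<alpha> \<in> {0, 1}}"

end

theory Submission
  imports Defs
begin

text \<open>
  Both sides of the equality count the same combinatorial objects: sets \<open>U\<close> of exponent vectors
  of degree between \<open>1\<close> and \<open>D\<close> that are upward closed within this range and have
  \<open>binom(n+L-1, L) - h(L)\<close> elements in each degree \<open>L\<close> (\<open>feasible_up_sets\<close>).

  A proper monomial ideal \<open>I\<close> generated in degrees at most \<open>D\<close> is recovered from its set of
  exponents of degree between \<open>1\<close> and \<open>D\<close>, as this set contains the exponents of all generators.
  Conversely, a monomial lies in the ideal generated by monomials only if it is a multiple of one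
  of them (\<open>monomial_in_span_iff\<close>), so that the ideal generated by an up-set \<open>U\<close> contains no
  monomials of degree at most \<open>D\<close> other than those of \<open>U\<close>.

  A 0-1 solution of the linear system is the indicator function of such a set \<open>U\<close>: the
  inequalities ask for closure under multiplication by a single variable, and every divisibility
  relation is a chain of these (\<open>up_closed_if_closed_under_covers\<close>).  Every 0-1 solution is in
  turn a vertex of the convex hull of all of them, because a number in \<open>{0, 1}\<close> is not a proper
  convex combination of other numbers in the unit interval (\<open>extreme_points_hull_zero_one\<close>).

  The number of exponent vectors of a given degree is the number of multisets of variables of
  that size, and the number of exponent vectors of degree at most \<open>D\<close> is the sum of these.
\<close>

section \<open>Exponent vectors\<close>

lemma total_degree_add: "total_degree (\<alpha> + \<beta>) = total_degree \<alpha> + total_degree \<beta>"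
  by (simp add: total_degree_def sum.distrib)

lemma total_degree_mono: "\<alpha> \<le> \<beta> \<Longrightarrow> total_degree \<alpha> \<le> total_degree \<beta>"
  by (simp add: total_degree_def less_eq_vec_def sum_mono)

lemma total_degree_eq_0_iff: "total_degree \<alpha> = 0 \<longleftrightarrow> \<alpha> = 0"
  by (simp add: total_degree_def vec_eq_iff)

lemma total_degree_axis: "total_degree (axis i 1 :: nat^'n) = 1"
  by (simp add: total_degree_def axis_def)

lemma bij_betw_multiset_exponents:
  "bij_betw (\<lambda>M. \<chi> i. count M i) (multisets_of_size UNIV L) {\<alpha> :: nat^'n. total_degree \<alpha> = L}"
proof (rule bij_betwI[where g = "\<lambda>\<alpha>. Abs_multiset (($) \<alpha>)"])
  have size: "size M = (\<Sum>i\<in>UNIV. count M i)" for M :: "'n multiset"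
    unfolding size_multiset_overloaded_eq by (rule sum.mono_neutral_left) (auto simp: not_in_iff)
  then show "(\<lambda>M. \<chi> i. count M i) \<in> multisets_of_size UNIV L \<rightarrow> {\<alpha> :: nat^'n. total_degree \<alpha> = L}"
    by (auto simp: multisets_of_size_def total_degree_def)
  show "(\<lambda>\<alpha>. Abs_multiset (($) \<alpha>)) \<in> {\<alpha> :: nat^'n. total_degree \<alpha> = L} \<rightarrow> multisets_of_size UNIV L"
    by (auto simp: multisets_of_size_def total_degree_def size)
  show "Abs_multiset (($) (\<chi> i. count M i)) = M" for M :: "'n multiset"
    by (rule multiset_eqI) simp
  show "(\<chi> i. count (Abs_multiset (($) \<alpha>)) i) = \<alpha>" for \<alpha> :: "nat^'n"
    by (simp add: vec_eq_iff)
qed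

lemma card_total_degree_eq:
  "card {\<alpha> :: nat^'n. total_degree \<alpha> = L} = (CARD('n) + L - 1) choose L"
  using bij_betw_same_card[OF bij_betw_multiset_exponents[where 'n = 'n and L = L]]
  by (simp add: card_multisets_of_size)

lemma finite_total_degree_eq: "finite {\<alpha> :: nat^'n. total_degree \<alpha> = L}"
  using bij_betw_finite[OF bij_betw_multiset_exponents[where 'n = 'n and L = L]]
  by (simp add: finite_multisets_of_size)

lemma total_degree_le_eq_UN:
  "{\<alpha> :: nat^'n. total_degree \<alpha> \<le> D} = (\<Union>L\<in>{..D}. {\<alpha>. total_degree \<alpha> = L})"
  by auto

lemma finite_variables: "finite (variables D :: (nat^'n) set)"
proof (rule finite_subset)
  show "finite {\<alpha> :: nat^'n. total_degree \<alpha> \<le> D}"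
    unfolding total_degree_le_eq_UN by (simp add: finite_total_degree_eq)
qed (auto simp: variables_def)

lemma card_total_degree_le:
  "card {\<alpha> :: nat^'n. total_degree \<alpha> \<le> D} = (CARD('n) + D) choose D"
proof -
  obtain m where m: "CARD('n) = Suc m"
    by (metis not0_implies_Suc zero_less_card_finite less_numeral_extra(3))
  have "card {\<alpha> :: nat^'n. total_degree \<alpha> \<le> D} =
      (\<Sum>L\<le>D. card {\<alpha> :: nat^'n. total_degree \<alpha> = L})"
    unfolding total_degree_le_eq_UN by (rule card_UN_disjoint) (auto simp: finite_total_degree_eq)
  also have "\<dots> = (\<Sum>L\<le>D. (m + L) choose L)"
    by (simp add: card_total_degree_eq m)
  also have "\<dots> = Suc (m + D) choose D"
    by (rule sum_choose_lower)
  finally show ?thesis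
    by (simp add: m)
qed

lemma card_variables: "card (variables D :: (nat^'n) set) = ((CARD('n) + D) choose D) - 1"
proof -
  have "variables D = {\<alpha> :: nat^'n. total_degree \<alpha> \<le> D} - {0}"
    by (auto simp: variables_def total_degree_eq_0_iff simp flip: neq0_conv)
  then show ?thesis
    by (simp add: card_Diff_singleton card_total_degree_le total_degree_eq_0_iff[THEN iffD2])
qed

text \<open>
  As long as \<open>\<alpha> \<noteq> \<gamma>\<close>, some entry of \<open>\<alpha>\<close> is smaller than that of \<open>\<gamma>\<close> and can be raised by one
  without leaving the range below \<open>\<gamma>\<close>.  Repeating this reaches \<open>\<gamma>\<close> by covering steps.
\<close>

lemma up_closed_if_closed_under_covers:
  fixes \<alpha> \<gamma> :: "nat^'n"
  assumes covers: "\<And>\<beta> \<delta>. \<lbrakk>\<beta> \<in> U; \<beta> \<le> \<delta>; total_degree \<beta> + 1 = total_degree \<delta>; total_degree \<delta> \<le> D\<rbrakk>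
      \<Longrightarrow> \<delta> \<in> U"
    and "\<alpha> \<in> U" "\<alpha> \<le> \<gamma>" "total_degree \<gamma> \<le> D"
  shows "\<gamma> \<in> U"
  using assms(2-4)
proof (induction "total_degree \<gamma> - total_degree \<alpha>" arbitrary: \<alpha> rule: less_induct)
  case less
  show ?case
  proof (cases "\<alpha> = \<gamma>")
    case False
    then obtain i where i: "\<alpha> $ i < \<gamma> $ i"
      using less.prems(2) unfolding less_eq_vec_def vec_eq_iff by (meson le_neq_implies_less)
    define \<beta> where "\<beta> = \<alpha> + axis i 1"
    have deg: "total_degree \<beta> = total_degree \<alpha> + 1"
      by (simp only: \<beta>_def total_degree_add total_degree_axis)
    have "\<beta> \<le> \<gamma>"
      using i less.prems(2) by (auto simp: \<beta>_def less_eq_vec_def axis_def)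
    moreover have "\<alpha> \<le> \<beta>"
      by (auto simp: \<beta>_def less_eq_vec_def)
    moreover note total_degree_mono[OF \<open>\<beta> \<le> \<gamma>\<close>]
    ultimately show ?thesis
      using less.hyps[of \<beta>] covers[of \<alpha> \<beta>] less.prems deg by auto
  qed (use less.prems in simp)
qed

section \<open>Monomials in monomial ideals\<close>

lemma keys_monomial: "Poly_Mapping.keys (monomial \<alpha> :: (nat^'n, 'k::field) poly_mapping) = {\<alpha>}"
  by (simp add: monomial_def)

lemma monomial_zero: "monomial 0 = 1"
  by (simp add: monomial_def)

lemma monomial_add:
  "(monomial (\<alpha> + \<beta>) :: (nat^'n, 'k::field) poly_mapping) = monomial \<alpha> * monomial \<beta>"
  by (simp add: monomial_def mult_single)

text \<open>
  The polynomials all of whose monomials are divisible by one of the generators form an ideal,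
  which therefore contains the ideal spanned by the generators.
\<close>

lemma monomial_in_span_iff:
  fixes A :: "(nat^'n) set"
  shows "(monomial \<alpha> :: (nat^'n, 'k::field) poly_mapping) \<in> ideal.span (monomial ` A)
    \<longleftrightarrow> (\<exists>\<beta>\<in>A. \<beta> \<le> \<alpha>)"
proof
  define J where
    "J = {p :: (nat^'n, 'k) poly_mapping. \<forall>\<alpha>\<in>Poly_Mapping.keys p. \<exists>\<beta>\<in>A. \<beta> \<le> \<alpha>}"
  have "ideal.subspace J"
  proof (rule ideal.subspaceI)
    fix p q assume "p \<in> J" "q \<in> J"
    then show "p + q \<in> J"
      using keys_add[of p q] by (auto simp: J_def)
  next
    fix c p assume p: "p \<in> J"
    have "\<exists>\<beta>\<in>A. \<beta> \<le> \<alpha>" if \<alpha>: "\<alpha> \<in> Poly_Mapping.keys (c * p)" for \<alpha>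
    proof -
      obtain \<gamma> \<delta> where "\<alpha> = \<gamma> + \<delta>" "\<delta> \<in> Poly_Mapping.keys p"
        using \<alpha> keys_mult[of c p] by blast
      moreover then obtain \<beta> where "\<beta> \<in> A" "\<beta> \<le> \<delta>"
        using p by (auto simp: J_def)
      ultimately show ?thesis
        by (auto simp: less_eq_vec_def intro!: bexI[of _ \<beta>] trans_le_add2)
    qed
    then show "c * p \<in> J"
      by (simp add: J_def)
  qed (simp add: J_def)
  moreover have "monomial ` A \<subseteq> J"
    by (auto simp: J_def keys_monomial)
  ultimately have "ideal.span (monomial ` A) \<subseteq> J"
    by (metis ideal.span_minimal)
  moreover assume "(monomial \<alpha> :: (nat^'n, 'k) poly_mapping) \<in> ideal.span (monomial ` A)"
  ultimately show "\<exists>\<beta>\<in>A. \<beta> \<le> \<alpha>"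
    by (auto simp: J_def keys_monomial)
next
  assume "\<exists>\<beta>\<in>A. \<beta> \<le> \<alpha>"
  then obtain \<beta> where \<beta>: "\<beta> \<in> A" "\<beta> \<le> \<alpha>"
    by blast
  then have "\<alpha> = (\<alpha> - \<beta>) + \<beta>"
    by (simp add: vec_eq_iff less_eq_vec_def)
  then have "(monomial \<alpha> :: (nat^'n, 'k) poly_mapping) = monomial (\<alpha> - \<beta>) * monomial \<beta>"
    by (metis monomial_add)
  then show "(monomial \<alpha> :: (nat^'n, 'k) poly_mapping) \<in> ideal.span (monomial ` A)"
    using \<beta>(1) by (metis ideal.span_base ideal.span_scale imageI)
qed

section \<open>Feasible up-sets\<close>

text \<open>
  The cardinality condition is additive so that no truncated subtraction of natural numbers
  occurs: if \<open>h(L)\<close> exceeds the number of monomials of degree \<open>L\<close> for some \<open>L\<close> between \<open>1\<close> and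
  \<open>D\<close>, there are no feasible sets, just as the linear system then has no 0-1 solutions.
\<close>

definition feasible_up_sets :: "nat \<Rightarrow> (nat \<Rightarrow> nat) \<Rightarrow> (nat^'n) set set" where
  "feasible_up_sets D h =
     {U. U \<subseteq> variables D \<and>
         (\<forall>\<alpha>\<in>U. \<forall>\<gamma>\<in>variables D. \<alpha> \<le> \<gamma> \<longrightarrow> \<gamma> \<in> U) \<and>
         (\<forall>L\<in>{1..D}. card {\<alpha> \<in> U. total_degree \<alpha> = L} + h L = (CARD('n) + L - 1) choose L)}"

lemma finite_feasible_up_sets: "finite (feasible_up_sets D h :: (nat^'n) set set)"
  by (rule finite_subset[OF _ finite_Pow_iff[THEN iffD2, OF finite_variables[of D]]])
    (auto simp: feasible_up_sets_def)

section \<open>Monomial ideals and feasible up-sets\<close>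

definition exponents_in :: "nat \<Rightarrow> (nat^'n, 'k::field) poly_mapping set \<Rightarrow> (nat^'n) set" where
  "exponents_in D I = {\<alpha> \<in> variables D. monomial \<alpha> \<in> I}"

lemma hilbert_fun_complement:
  fixes I :: "(nat^'n, 'k::field) poly_mapping set"
  assumes "L \<in> {1..D}"
  shows "card {\<alpha> \<in> exponents_in D I. total_degree \<alpha> = L} + hilbert_fun I L =
    (CARD('n) + L - 1) choose L"
proof -
  have "{\<alpha> \<in> exponents_in D I. total_degree \<alpha> = L} =
      {\<alpha>. total_degree \<alpha> = L \<and> (monomial \<alpha> :: (nat^'n, 'k) poly_mapping) \<in> I}"
    using assms by (auto simp: exponents_in_def variables_def)
  then have "card {\<alpha> \<in> exponents_in D I. total_degree \<alpha> = L} + hilbert_fun I L =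
      card ({\<alpha>. total_degree \<alpha> = L \<and> (monomial \<alpha> :: (nat^'n, 'k) poly_mapping) \<in> I} \<union>
        {\<alpha>. total_degree \<alpha> = L \<and> (monomial \<alpha> :: (nat^'n, 'k) poly_mapping) \<notin> I})"
    unfolding hilbert_fun_def
    by (subst card_Un_disjoint) (auto intro: finite_subset[OF _ finite_total_degree_eq[of L]])
  also have "\<dots> = card {\<alpha> :: nat^'n. total_degree \<alpha> = L}"
    by (rule arg_cong[of _ _ card]) auto
  finally show ?thesis
    by (simp add: card_total_degree_eq)
qed

lemma hilbert_fun_eq_iff:
  fixes I :: "(nat^'n, 'k::field) poly_mapping set"
  assumes "L \<in> {1..D}"
  shows "hilbert_fun I L = h L \<longleftrightarrow>
    card {\<alpha> \<in> exponents_in D I. total_degree \<alpha> = L} + h L = (CARD('n) + L - 1) choose L"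
  using hilbert_fun_complement[OF assms, of I] by linarith

lemma exponents_in_span_up_set:
  fixes U :: "(nat^'n) set"
  assumes "U \<subseteq> variables D" "\<forall>\<alpha>\<in>U. \<forall>\<gamma>\<in>variables D. \<alpha> \<le> \<gamma> \<longrightarrow> \<gamma> \<in> U"
  shows "exponents_in D (ideal.span (monomial ` U) :: (nat^'n, 'k::field) poly_mapping set) = U"
  using assms by (auto simp: exponents_in_def monomial_in_span_iff)

text \<open>
  Properness enters here: a generator \<open>x\<^sup>0 = 1\<close> would give the unit ideal, so the generators all
  have positive degree and are among the monomials that \<open>exponents_in\<close> records.
\<close>

lemma span_exponents_in:
  fixes I :: "(nat^'n, 'k::field) poly_mapping set"
  assumes "I \<in> monomial_ideals D h"
  shows "ideal.span (monomial ` exponents_in D I) = I"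
proof -
  obtain A where A: "\<forall>\<alpha>\<in>A. total_degree \<alpha> \<le> D" "I = ideal.span (monomial ` A)" and "I \<noteq> UNIV"
    using assms by (auto simp: monomial_ideals_def)
  have "0 \<notin> A"
  proof
    assume "0 \<in> A"
    then have "1 \<in> I"
      unfolding A(2) by (metis monomial_zero ideal.span_base imageI)
    then have "p \<in> I" for p
      using ideal.span_scale[of 1 "monomial ` A" p] by (simp add: A(2))
    with \<open>I \<noteq> UNIV\<close> show False
      by blast
  qed
  then have "A \<subseteq> exponents_in D I"
    using A(1) by (auto simp: exponents_in_def variables_def A(2) ideal.span_base
      total_degree_eq_0_iff simp flip: neq0_conv)
  then have "I \<subseteq> ideal.span (monomial ` exponents_in D I)"
    unfolding A(2) by (intro ideal.span_mono image_mono)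
  moreover have "ideal.span (monomial ` exponents_in D I) \<subseteq> I"
    unfolding A(2)
    by (intro ideal.span_minimal ideal.subspace_span) (auto simp: exponents_in_def)
  ultimately show ?thesis
    by blast
qed

lemma bij_betw_monomial_ideals:
  "bij_betw (exponents_in D)
     (monomial_ideals D h :: (nat^'n, 'k::field) poly_mapping set set) (feasible_up_sets D h)"
proof (rule bij_betwI[where g = "\<lambda>U. ideal.span (monomial ` U)"])
  show "exponents_in D \<in>
      (monomial_ideals D h :: (nat^'n, 'k) poly_mapping set set) \<rightarrow> feasible_up_sets D h"
  proof
    fix I :: "(nat^'n, 'k) poly_mapping set"
    assume I: "I \<in> monomial_ideals D h"
    then obtain A where A: "I = ideal.span (monomial ` A)"
      by (auto simp: monomial_ideals_def)
    have "\<gamma> \<in> exponents_in D I"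
      if "\<alpha> \<in> exponents_in D I" "\<gamma> \<in> variables D" "\<alpha> \<le> \<gamma>" for \<alpha> \<gamma>
      using that unfolding A exponents_in_def mem_Collect_eq monomial_in_span_iff
      by (meson order_trans)
    moreover have "\<forall>L\<in>{1..D}. card {\<alpha> \<in> exponents_in D I. total_degree \<alpha> = L} + h L =
        (CARD('n) + L - 1) choose L"
      using I hilbert_fun_eq_iff[of _ D I h] by (auto simp: monomial_ideals_def)
    ultimately show "exponents_in D I \<in> feasible_up_sets D h"
      by (auto simp: feasible_up_sets_def exponents_in_def)
  qed
next
  show "(\<lambda>U. ideal.span (monomial ` U)) \<in>
      feasible_up_sets D h \<rightarrow> (monomial_ideals D h :: (nat^'n, 'k) poly_mapping set set)"
  proof
    fix U :: "(nat^'n) set"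
    assume U: "U \<in> feasible_up_sets D h"
    define I :: "(nat^'n, 'k) poly_mapping set" where "I = ideal.span (monomial ` U)"
    have exp: "exponents_in D I = U"
      using U unfolding I_def by (intro exponents_in_span_up_set) (auto simp: feasible_up_sets_def)
    have "monomial 0 \<notin> I"
      using U total_degree_mono[of _ 0] unfolding I_def monomial_in_span_iff
      by (fastforce simp: feasible_up_sets_def variables_def total_degree_eq_0_iff[THEN iffD2])
    then have "I \<noteq> UNIV"
      by blast
    moreover have "\<forall>L\<in>{1..D}. hilbert_fun I L = h L"
      using U hilbert_fun_eq_iff[of _ D I h] by (auto simp: exp feasible_up_sets_def)
    moreover have "\<forall>\<alpha>\<in>U. total_degree \<alpha> \<le> D"
      using U by (auto simp: feasible_up_sets_def variables_def)
    ultimately show "ideal.span (monomial ` U) \<in>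
        (monomial_ideals D h :: (nat^'n, 'k) poly_mapping set set)"
      unfolding monomial_ideals_def I_def by blast
  qed
next
  show "ideal.span (monomial ` exponents_in D I) = I"
    if "I \<in> monomial_ideals D h" for I :: "(nat^'n, 'k) poly_mapping set"
    using that by (rule span_exponents_in)
  show "exponents_in D (ideal.span (monomial ` U) :: (nat^'n, 'k) poly_mapping set) = U"
    if "U \<in> feasible_up_sets D h" for U :: "(nat^'n) set"
    using that by (intro exponents_in_span_up_set) (auto simp: feasible_up_sets_def)
qed

section \<open>0-1 solutions and feasible up-sets\<close>

definition zero_one_solutions :: "nat \<Rightarrow> (nat \<Rightarrow> nat) \<Rightarrow> (nat^'n, real) poly_mapping set" where
  "zero_one_solutions D h =
     {x \<in> linear_system D h. \<forall>\<alpha>\<in>variables D. Poly_Mapping.lookup x \<alpha> \<in> {0, 1}}"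

definition indicator_point :: "'a set \<Rightarrow> ('a, real) poly_mapping" where
  "indicator_point U = (\<Sum>\<alpha>\<in>U. Poly_Mapping.single \<alpha> 1)"

lemma lookup_indicator_point:
  assumes "finite U"
  shows "Poly_Mapping.lookup (indicator_point U) \<alpha> = (if \<alpha> \<in> U then 1 else 0)"
  using assms by (simp add: indicator_point_def lookup_sum lookup_single when_def)

lemma keys_indicator_point: "finite U \<Longrightarrow> Poly_Mapping.keys (indicator_point U) = U"
  by (auto simp: in_keys_iff lookup_indicator_point split: if_splits)

lemma indicator_point_keys:
  assumes "\<And>\<alpha>. Poly_Mapping.lookup x \<alpha> \<in> {0, 1}"
  shows "indicator_point (Poly_Mapping.keys x) = x"
  using assms by (intro poly_mapping_eqI) (auto simp: lookup_indicator_point in_keys_iff)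

lemma indicator_point_solution_iff:
  fixes U :: "(nat^'n) set"
  assumes U: "U \<subseteq> variables D"
  shows "indicator_point U \<in> linear_system D h \<longleftrightarrow> U \<in> feasible_up_sets D h"
proof -
  have fin: "finite U"
    using U finite_variables by (rule finite_subset)
  have "(\<Sum>\<alpha> | total_degree \<alpha> = L. Poly_Mapping.lookup (indicator_point U) \<alpha>) =
      real (card {\<alpha> \<in> U. total_degree \<alpha> = L})" for L
    using finite_total_degree_eq[where 'n = 'n and L = L]
    by (simp add: lookup_indicator_point fin sum.If_cases Int_def conj_commute)
  then have sum_iff: "(\<Sum>\<alpha> | total_degree \<alpha> = L. Poly_Mapping.lookup (indicator_point U) \<alpha>) =
        real ((CARD('n) + L - 1) choose L) - real (h L) \<longleftrightarrow>
      card {\<alpha> \<in> U. total_degree \<alpha> = L} + h L = (CARD('n) + L - 1) choose L" for L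
    by (simp add: eq_diff_eq flip: of_nat_add)
  have covers_iff: "(\<forall>\<alpha>\<in>variables D. \<forall>\<gamma>\<in>variables D.
        \<alpha> \<le> \<gamma> \<and> total_degree \<alpha> + 1 = total_degree \<gamma> \<longrightarrow>
        Poly_Mapping.lookup (indicator_point U) \<alpha> \<le> Poly_Mapping.lookup (indicator_point U) \<gamma>) \<longleftrightarrow>
      (\<forall>\<alpha>\<in>U. \<forall>\<gamma>\<in>variables D. \<alpha> \<le> \<gamma> \<longrightarrow> \<gamma> \<in> U)" (is "?covers \<longleftrightarrow> ?up")
  proof
    assume covers: ?covers
    have step: "\<delta> \<in> U" if "\<beta> \<in> U" "\<beta> \<le> \<delta>" "total_degree \<beta> + 1 = total_degree \<delta>"
      "total_degree \<delta> \<le> D" for \<beta> \<delta>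
    proof -
      have "\<beta> \<in> variables D" "\<delta> \<in> variables D"
        using that U by (auto simp: variables_def)
      then have "Poly_Mapping.lookup (indicator_point U) \<beta> \<le>
          Poly_Mapping.lookup (indicator_point U) \<delta>"
        using covers that by blast
      then show ?thesis
        using \<open>\<beta> \<in> U\<close> by (auto simp: lookup_indicator_point fin split: if_splits)
    qed
    show ?up
    proof (intro ballI impI)
      fix \<alpha> \<gamma> assume "\<alpha> \<in> U" "\<gamma> \<in> variables D" "\<alpha> \<le> \<gamma>"
      moreover from this have "total_degree \<gamma> \<le> D"
        by (simp add: variables_def)
      ultimately show "\<gamma> \<in> U"
        using up_closed_if_closed_under_covers[of U D \<alpha> \<gamma>] step by blast
    qed
  next
    assume ?up
    then show ?covers
      by (auto simp: lookup_indicator_point fin)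
  qed
  show ?thesis
    unfolding linear_system_def feasible_up_sets_def mem_Collect_eq keys_indicator_point[OF fin]
      sum_iff covers_iff by (intro iffI conjI; elim conjE; assumption)
qed

lemma lookup_zero_one_solution:
  assumes "x \<in> zero_one_solutions D h"
  shows "Poly_Mapping.lookup x \<alpha> \<in> {0, 1}"
  using assms by (cases "\<alpha> \<in> variables D")
    (auto simp: zero_one_solutions_def linear_system_def in_keys_iff)

lemma bij_betw_zero_one_solutions:
  "bij_betw Poly_Mapping.keys
     (zero_one_solutions D h :: (nat^'n, real) poly_mapping set) (feasible_up_sets D h)"
proof (rule bij_betwI[where g = indicator_point])
  show "Poly_Mapping.keys \<in>
      (zero_one_solutions D h :: (nat^'n, real) poly_mapping set) \<rightarrow> feasible_up_sets D h"
  proof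
    fix x :: "(nat^'n, real) poly_mapping"
    assume x: "x \<in> zero_one_solutions D h"
    then have "Poly_Mapping.keys x \<subseteq> variables D" "x \<in> linear_system D h"
      by (auto simp: zero_one_solutions_def linear_system_def)
    then show "Poly_Mapping.keys x \<in> feasible_up_sets D h"
      using indicator_point_solution_iff[of "Poly_Mapping.keys x" D h]
      by (simp add: indicator_point_keys[OF lookup_zero_one_solution[OF x]])
  qed
next
  have sub: "U \<subseteq> variables D" and fin: "finite U"
    if "U \<in> feasible_up_sets D h" for U :: "(nat^'n) set"
    using that finite_subset[OF _ finite_variables[of D]] by (auto simp: feasible_up_sets_def)
  show "indicator_point \<in>
      feasible_up_sets D h \<rightarrow> (zero_one_solutions D h :: (nat^'n, real) poly_mapping set)"
    by (auto simp: zero_one_solutions_def indicator_point_solution_iff sub fin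
      lookup_indicator_point)
  show "Poly_Mapping.keys (indicator_point U) = U"
    if "U \<in> feasible_up_sets D h" for U :: "(nat^'n) set"
    using fin[OF that] by (rule keys_indicator_point)
  show "indicator_point (Poly_Mapping.keys x) = x"
    if "x \<in> zero_one_solutions D h" for x :: "(nat^'n, real) poly_mapping"
    using lookup_zero_one_solution[OF that] by (rule indicator_point_keys)
qed

section \<open>Vertices of 0-1 polytopes\<close>

lemma lookup_scaleR_poly_mapping:
  fixes x :: "('a, 'b::real_vector) poly_mapping"
  shows "Poly_Mapping.lookup (r *\<^sub>R x) i = r *\<^sub>R Poly_Mapping.lookup x i"
proof -
  have "finite {i. r *\<^sub>R Poly_Mapping.lookup x i \<noteq> 0}"
    by (rule finite_subset[OF _ finite_keys[of x]]) (auto simp: in_keys_iff)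
  then show ?thesis
    by (simp add: scaleR_poly_mapping_def)
qed

text \<open>
  Each summand of the convex combination lies between \<open>0\<close> and its weight.  A total of \<open>0\<close> forces
  both summands to their lower bounds, a total of \<open>1\<close> both to their upper bounds.
\<close>

lemma convex_combination_zero_one_imp_eq:
  fixes a b u :: real
  assumes "a \<in> {0..1}" "b \<in> {0..1}" "0 < u" "u < 1" "(1 - u) * a + u * b \<in> {0, 1}"
  shows "a = b"
proof -
  have "0 \<le> (1 - u) * a" "0 \<le> u * b" "(1 - u) * a \<le> 1 - u" "u * b \<le> u"
    using assms by (auto intro: mult_left_le)
  moreover have "(1 - u) * a + u * b = 0 \<or> (1 - u) * a + u * b = 1"
    using assms(5) by simp
  ultimately have "(1 - u) * a = 0 \<and> u * b = 0 \<or> (1 - u) * a = 1 - u \<and> u * b = u"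
    by linarith
  then show ?thesis
    using assms(3,4) by auto
qed

text \<open>
  The hull lies in the unit cube.  If a point of \<open>S\<close> is a proper convex combination of two points
  of the hull, then each of its coordinates, being \<open>0\<close> or \<open>1\<close>, is the same combination of two
  numbers in the unit interval, which must then agree; so the two points are equal.
\<close>

lemma extreme_points_hull_zero_one:
  fixes S :: "('a, real) poly_mapping set"
  assumes S: "\<And>x i. x \<in> S \<Longrightarrow> Poly_Mapping.lookup x i \<in> {0, 1}"
  shows "{v. v extreme_point_of (convex hull S)} = S"
proof
  show "{v. v extreme_point_of (convex hull S)} \<subseteq> S"
    by (rule extreme_points_of_convex_hull)
next
  define C :: "('a, real) poly_mapping set" where
    "C = {x. \<forall>i. Poly_Mapping.lookup x i \<in> {0..1}}"
  have "convex C"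
    unfolding convex_def
  proof (intro ballI allI impI)
    fix x y :: "('a, real) poly_mapping" and r s :: real
    assume "x \<in> C" "y \<in> C" "0 \<le> r" "0 \<le> s" "r + s = 1"
    then show "r *\<^sub>R x + s *\<^sub>R y \<in> C"
      by (simp add: C_def lookup_add lookup_scaleR_poly_mapping convex_bound_le)
  qed
  moreover have "S \<subseteq> C"
  proof
    fix x assume "x \<in> S"
    then have "Poly_Mapping.lookup x i \<in> {0..1}" for i
      using S[of x i] by auto
    then show "x \<in> C"
      by (simp add: C_def)
  qed
  ultimately have C: "convex hull S \<subseteq> C"
    by (rule hull_minimal[rotated])
  have "v \<notin> open_segment a b" if v: "v \<in> S" and ab: "a \<in> convex hull S" "b \<in> convex hull S"
    for v a b
  proof
    assume "v \<in> open_segment a b"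
    then obtain u where "a \<noteq> b" and u: "0 < u" "u < 1" "v = (1 - u) *\<^sub>R a + u *\<^sub>R b"
      by (auto simp: in_segment)
    have "Poly_Mapping.lookup a i = Poly_Mapping.lookup b i" for i
      using convex_combination_zero_one_imp_eq[of "Poly_Mapping.lookup a i" "Poly_Mapping.lookup b i" u]
        ab C S[OF v, of i] u
      by (auto simp: C_def lookup_add lookup_scaleR_poly_mapping)
    with \<open>a \<noteq> b\<close> show False
      by (metis poly_mapping_eqI)
  qed
  then show "S \<subseteq> {v. v extreme_point_of (convex hull S)}"
    by (auto simp: extreme_point_of_def hull_inc)
qed

lemma Q_polytope_eq_hull: "Q_polytope D h = convex hull (zero_one_solutions D h)"
  by (simp add: Q_polytope_def zero_one_solutions_def)

theorem lemma2p3: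
  fixes D :: nat and h :: "nat \<Rightarrow> nat"
  shows "finite (monomial_ideals D h :: (nat^'n, 'k::field) poly_mapping set set) \<and>
         polytope (Q_polytope D h :: (nat^'n, real) poly_mapping set) \<and>
         card (monomial_ideals D h :: (nat^'n, 'k) poly_mapping set set) =
           card {v :: (nat^'n, real) poly_mapping. v extreme_point_of Q_polytope D h} \<and>
         card (variables D :: (nat^'n) set) = ((CARD('n) + D) choose D) - 1"
proof (intro conjI)
  note ideals = bij_betw_monomial_ideals[where 'n = 'n and 'k = 'k and D = D and h = h]
  note points = bij_betw_zero_one_solutions[where 'n = 'n and D = D and h = h]
  show "finite (monomial_ideals D h :: (nat^'n, 'k) poly_mapping set set)"
    using bij_betw_finite[OF ideals] finite_feasible_up_sets by blast
  have "finite (zero_one_solutions D h :: (nat^'n, real) poly_mapping set)"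
    using bij_betw_finite[OF points] finite_feasible_up_sets by blast
  then show "polytope (Q_polytope D h :: (nat^'n, real) poly_mapping set)"
    unfolding Q_polytope_eq_hull polytope_def by blast
  have "{v :: (nat^'n, real) poly_mapping. v extreme_point_of Q_polytope D h} =
      zero_one_solutions D h"
    unfolding Q_polytope_eq_hull using lookup_zero_one_solution
    by (rule extreme_points_hull_zero_one)
  then show "card (monomial_ideals D h :: (nat^'n, 'k) poly_mapping set set) =
      card {v :: (nat^'n, real) poly_mapping. v extreme_point_of Q_polytope D h}"
    using bij_betw_same_card[OF ideals] bij_betw_same_card[OF points] by simp
  show "card (variables D :: (nat^'n) set) = ((CARD('n) + D) choose D) - 1"
    by (rule card_variables)
qed

end
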